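(* Let $a,b,c$ be complex numbers with $a,b,c,b-c,a+b-c\notin\mathbb Z$ and $a-c\notin\mathbb Z\setminus\{0\}$, let $k$ be an arbitrary integer and $M$ a non-negative integer. Then $$\sum_{n=-\infty}^{\infty}\frac{(a)_n\,(c+k)_n\,(1+c-b+M)_n}{(1+a+k)_n\,(1+c+M)_n\,(1+c-b)_n} =\frac{\Gamma(1+a)\,\Gamma(1-a)\,\Gamma(1+c)\,\Gamma(1-c)}{\Gamma(1+a-c)\,\Gamma(1+c-a)}\cdot\frac{(-M)_k\,(1+a)_k\,(b)_k}{(1)_k\,(c)_k\,(a+b-c-M)_k}\cdot\frac{(1+c)_M\,(1+c-a-b)_M}{(1+c-a)_M\,(1+c-b)_M}.$$ (The left-hand side is the bilateral hypergeometric series ${}_3H_3\!\left[\begin{matrix}a,\,c+k,\,1+c-b+M\\ 1+a+k,\,1+c+M,\,1+c-b\end{matrix};1\right]$.)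
   Context: For $k\in\mathbb Z$ the shifted factorial is $(x)_k=\Gamma(x+k)/\Gamma(x)$, i.e. $(x)_k=\prod_{j=0}^{k-1}(x+j)$ for $k\ge0$ and $(x)_{k}=1/\prod_{j=1}^{-k}(x-j)$ for $k<0$ (this product form is used for $(-M)_k$). The convention $1/(1)_k=0$ for $k<0$ is in force, so the right-hand side is $0$ when $k<0$. The bilateral series is ${}_rH_r\!\left[\begin{matrix}a_1,\dots,a_r\\ b_1,\dots,b_r\end{matrix};z\right]=\sum_{n=-\infty}^{\infty}\frac{(a_1)_n\cdots(a_r)_n}{(b_1)_n\cdots(b_r)_n}z^n$. *)

theory Defs
  imports "HOL-Analysis.Analysis"
begin

definition shifted_factorial :: "complex \<Rightarrow> int \<Rightarrow> complex" where
  "shifted_factorial x k =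
     (if k \<ge> 0 then \<Prod>j<nat k. x + of_nat j
      else 1 / (\<Prod>j=1..nat (- k). x - of_nat j))"

lemma shifted_factorial_eq_Gamma:
  assumes "x \<notin> \<int>"
  shows "shifted_factorial x k = Gamma (x + of_int k) / Gamma x"
proof (cases "k \<ge> 0")
  case True
  have "pochhammer x (nat k) = Gamma (x + of_nat (nat k)) / Gamma x"
    using assms nonpos_Ints_Int by (intro pochhammer_Gamma) auto
  with True show ?thesis
    by (simp add: shifted_factorial_def pochhammer_prod atLeast0LessThan)
next
  case False
  define m where "m = nat (- k)"
  define y where "y = x + of_int k"
  have k: "k = - int m" using False by (simp add: m_def)
  have "y \<notin> \<int>"
    using assms Ints_diff[of y "of_int k"] by (auto simp: y_def)
  hence "pochhammer y m = Gamma (y + of_nat m) / Gamma y"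
    using nonpos_Ints_Int by (intro pochhammer_Gamma) auto
  moreover have "pochhammer y m = (\<Prod>j=1..m. x - of_nat j)"
    unfolding pochhammer_prod
    by (rule prod.reindex_bij_witness[of _ "\<lambda>j. m - j" "\<lambda>i. m - i"])
       (auto simp: y_def k of_nat_diff)
  moreover have "y + of_nat m = x" by (simp add: y_def k)
  ultimately have "(\<Prod>j=1..m. x - of_nat j) = Gamma x / Gamma y" by simp
  thus ?thesis
    using False by (simp add: shifted_factorial_def flip: m_def y_def)
qed

text \<open>
  Since division by zero yields zero, the convention that the reciprocal of
  \<open>(1)\<^sub>k\<close> vanishes for negative \<open>k\<close> holds for this definition.
\<close>

lemma inverse_shifted_factorial_one_neg:
  assumes "k < 0"
  shows "1 / shifted_factorial 1 k = 0"
proof -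
  have "(\<Prod>j=1..nat (- k). (1 :: complex) - of_nat j) = 0"
    using assms by (intro prod_zero bexI[of _ 1]) auto
  with assms show ?thesis by (simp add: shifted_factorial_def)
qed

end

(*
  Writing beta = 1 + c - b, the summand is a constant times

    f k M n = G(n+a) / G(n+a+k+1) * G(n+c+k) / G(n+c+M+1) * (n+beta)_M   (G the Gamma function),

  a rational function of n with n^2 f -> 1 at both ends. With D the forward difference in n,

    (k+1)(a+1-beta-M+k) f (k+1) M - (1+c-beta+k)(k-M) f k M = D [(n+beta-1)(n+c+M) f k M],
    (M+1)(c-a+1+M) f 0 (M+1) - (M+1)(beta-a+M) f 0 M        = D [(n+beta-1)(n+a) f 0 M].

  The functions in brackets tend to 1 at both ends, so the right-hand sides sum to 0 and the
  sum over n obeys two first-order recurrences. The k-recurrence degenerates at k = -1 and at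
  k = M, which forces the sum to vanish for k < 0 and for k > M. Everything is thereby reduced
  to k = M = 0, the sum of 1/((n+a)(n+c)), which follows from the reflection formulas for the
  digamma function (a different from c) and its derivative (a = c).
*)
theory Submission
  imports Defs
begin

section \<open>Unconditional sums over the integers: splitting, decay, telescoping\<close>

lemma has_sum_int_split:
  fixes f :: "int \<Rightarrow> 'a :: banach"
  assumes "((\<lambda>n. f (int n)) has_sum A) UNIV" "((\<lambda>n. f (- int n - 1)) has_sum B) UNIV"
  shows   "(f has_sum (A + B)) UNIV"
proof -
  have "((\<lambda>n. f (int n)) has_sum A) UNIV \<longleftrightarrow> (f has_sum A) {0..}"
    by (rule has_sum_reindex_bij_witness[of _ nat int]) auto
  moreover have "((\<lambda>n. f (- int n - 1)) has_sum B) UNIV \<longleftrightarrow> (f has_sum B) {..<0}"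
    by (rule has_sum_reindex_bij_witness[of _ "\<lambda>n. nat (- n - 1)" "\<lambda>n. - int n - 1"]) auto
  ultimately have "(f has_sum (A + B)) ({0..} \<union> {..<0})"
    using assms by (intro has_sum_Un_disjoint) auto
  moreover have "{0..} \<union> {..<0} = (UNIV :: int set)" by auto
  ultimately show ?thesis by simp
qed

text \<open>The classical series give only ordered one-sided limits. Both halves inherit
  unconditional summability from \<open>f\<close>, so these limits are their unconditional
  sums.\<close>

lemma has_sum_int_sums:
  fixes f :: "int \<Rightarrow> 'a :: banach"
  assumes "f summable_on UNIV" "(\<lambda>n. f (int n)) sums A" "(\<lambda>n. f (- int n - 1)) sums B"
  shows   "(f has_sum (A + B)) UNIV"
proof -
  have "(f \<circ> g) summable_on UNIV" if "inj g" for g :: "nat \<Rightarrow> int"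
    using summable_on_subset_banach[OF assms(1), of "range g"] summable_on_reindex[OF that, of f]
    by simp
  from this[of int] this[of "\<lambda>n. - int n - 1"]
  have "(\<lambda>n. f (int n)) summable_on UNIV" "(\<lambda>n. f (- int n - 1)) summable_on UNIV"
    by (auto simp: o_def inj_def)
  hence "((\<lambda>n. f (int n)) has_sum A) UNIV" "((\<lambda>n. f (- int n - 1)) has_sum B) UNIV"
    using assms(2,3) by (metis has_sum_imp_sums has_sum_infsum sums_unique2)+
  thus ?thesis by (rule has_sum_int_split)
qed

text \<open>On the integers \<open>cofinite\<close> describes both ends at once; a single limit
  along it replaces the limits at plus and minus infinity.\<close>

lemma filterlim_of_int_cofinite:
  "filterlim (of_int :: int \<Rightarrow> 'a :: real_normed_algebra_1) at_infinity cofinite"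
  unfolding filterlim_at_infinity[OF order_refl]
proof (intro allI impI)
  fix r :: real
  have "{n :: int. \<not> r \<le> norm (of_int n :: 'a)} \<subseteq> {- \<lceil>r\<rceil>..\<lceil>r\<rceil>}"
    by (auto simp: norm_of_int) linarith+
  thus "eventually (\<lambda>n. r \<le> norm (of_int n :: 'a)) cofinite"
    unfolding eventually_cofinite by (rule finite_subset) auto
qed

text \<open>The ratio is \<open>1 + (x - y) / (n + y)\<close>, except possibly at one integer where
  the denominator vanishes, which a cofinite limit ignores.\<close>

lemma tendsto_shift_ratio:
  "((\<lambda>n :: int. (of_int n + x) / (of_int n + y) :: complex) \<longlongrightarrow> 1) cofinite"
proof -
  have inf: "filterlim (\<lambda>n :: int. of_int n + y :: complex) at_infinity cofinite"
    by (subst add.commute)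
       (intro tendsto_add_filterlim_at_infinity[OF tendsto_const] filterlim_of_int_cofinite)
  have "((\<lambda>n :: int. 1 + (x - y) * inverse (of_int n + y) :: complex) \<longlongrightarrow> 1 + (x - y) * 0) cofinite"
    by (intro tendsto_intros filterlim_compose[OF tendsto_inverse_0 inf])
  hence "((\<lambda>n :: int. 1 + (x - y) * inverse (of_int n + y) :: complex) \<longlongrightarrow> 1) cofinite" by simp
  moreover have "eventually (\<lambda>n :: int. of_int n + y \<noteq> 0) cofinite"
    using inf filterlim_at_infinity_imp_eventually_ne by blast
  hence "eventually (\<lambda>n :: int. 1 + (x - y) * inverse (of_int n + y) = (of_int n + x) / (of_int n + y)) cofinite"
    by eventually_elim (simp add: field_simps)
  ultimately show ?thesis by (rule Lim_transform_eventually)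
qed

lemma summable_on_inverse_square_int: "(\<lambda>n :: int. 1 / (of_int n)\<^sup>2 :: real) summable_on UNIV"
proof -
  have "summable (\<lambda>n. 1 / (of_nat n)\<^sup>2 :: real)"
    using inverse_power_summable[of 2, where ?'a = real] by (simp add: divide_inverse)
  moreover from this have "summable (\<lambda>n. 1 / (of_nat (Suc n))\<^sup>2 :: real)"
    by (subst summable_Suc_iff)
  moreover have "(- real n - 1)\<^sup>2 = (of_nat (Suc n))\<^sup>2" for n
    by (simp add: power2_eq_square algebra_simps)
  \<comment> \<open>The nonnegative half starts with \<open>1 / 0 = 0\<close>; the negative half is
    the same series shifted by one.\<close>
  ultimately have "(\<lambda>n. 1 / (of_int (int n))\<^sup>2 :: real) summable_on UNIV"
    "(\<lambda>n. 1 / (of_int (- int n - 1))\<^sup>2 :: real) summable_on UNIV"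
    by (auto intro!: summable_nonneg_imp_summable_on)
  thus ?thesis
    using has_sum_int_split[of "\<lambda>n. 1 / (of_int n)\<^sup>2 :: real"] unfolding summable_on_def by blast
qed

lemma summable_on_int_quadratic_decay:
  fixes f :: "int \<Rightarrow> 'a :: {real_normed_field, banach}"
  assumes "((\<lambda>n. (of_int n)\<^sup>2 * f n) \<longlongrightarrow> L) cofinite"
  shows   "f summable_on UNIV"
proof -
  define C where "C = norm L + 1"
  have "eventually (\<lambda>n. norm ((of_int n)\<^sup>2 * f n) < C) cofinite"
    using tendsto_norm[OF assms] by (rule order_tendstoD) (simp add: C_def)
  hence fin: "finite {n. \<not> norm ((of_int n)\<^sup>2 * f n) < C}" (is "finite ?X")
    by (simp add: eventually_cofinite)
  \<comment> \<open>Zero joins the exceptional set because the comparison there would read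
    \<open>norm (f 0) \<le> 0\<close>.\<close>
  hence fin': "finite (insert 0 ?X)" (is "finite ?Y") by simp
  have "(\<lambda>n. norm (f n)) summable_on (- ?Y)"
  proof (rule Infinite_Sum.abs_summable_on_comparison_test')
    show "(\<lambda>n. C * (1 / (of_int n)\<^sup>2)) summable_on (- ?Y)"
      by (intro summable_on_cmult_right summable_on_subset_banach[OF summable_on_inverse_square_int]) auto
    show "norm (f n) \<le> C * (1 / (of_int n)\<^sup>2)" if "n \<in> - ?Y" for n
      using that by (auto simp: field_simps norm_mult norm_power)
  qed
  hence "f summable_on (- ?Y)" by (rule abs_summable_summable)
  moreover have "f summable_on ?Y" using fin' by (rule summable_on_finite)
  ultimately have "f summable_on (?Y \<union> - ?Y)" by (intro summable_on_Un_disjoint) auto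
  thus ?thesis by (simp add: Un_UNIV_left)
qed

text \<open>Sums over symmetric intervals collapse to \<open>G N - G (- N)\<close>, which tends to
  \<open>L - L\<close> because the limit is the same at both ends. Summability allows the sum to be
  computed along these intervals.\<close>

lemma has_sum_int_telescope:
  fixes G :: "int \<Rightarrow> 'a :: banach"
  assumes "(G \<longlongrightarrow> L) cofinite" "(\<lambda>n. G (n + 1) - G n) summable_on UNIV"
  shows   "((\<lambda>n. G (n + 1) - G n) has_sum 0) UNIV"
proof -
  define D where "D = (\<lambda>n. G (n + 1) - G n)"
  obtain S where S: "(D has_sum S) UNIV"
    using assms(2) by (auto simp: D_def summable_on_def)
  have "filterlim (\<lambda>N. {- int N..<int N}) (finite_subsets_at_top UNIV) sequentially"
    unfolding filterlim_finite_subsets_at_top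
  proof safe
    fix X :: "int set" assume X: "finite X"
    \<comment> \<open>The right end of the interval is excluded, so a strict bound on absolute
      values is needed; hence the added 1.\<close>
    define m where "m = nat (Max (insert 0 (abs ` X))) + 1"
    have "\<bar>x\<bar> < int m" if "x \<in> X" for x
    proof -
      have "\<bar>x\<bar> \<le> Max (insert 0 (abs ` X))" "0 \<le> Max (insert 0 (abs ` X))"
        using X that by (intro Max_ge; simp)+
      thus ?thesis by (simp add: m_def)
    qed
    hence "X \<subseteq> {- int N..<int N}" if "N \<ge> m" for N
      using that by fastforce
    thus "\<forall>\<^sub>F N in sequentially. finite {- int N..<int N} \<and> X \<subseteq> {- int N..<int N} \<and> {- int N..<int N} \<subseteq> UNIV"
      by (auto simp: eventually_at_top_linorder)
  qed
  with S have "(\<lambda>N. sum D {- int N..<int N}) \<longlonglongrightarrow> S"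
    unfolding has_sum_def by (rule filterlim_compose)
  moreover have "sum D {- int N..<int N} = G (int N) - G (- int N)" for N
  proof (induction N)
    case (Suc N)
    have "{- int (Suc N)..<int (Suc N)} = insert (- int N - 1) (insert (int N) {- int N..<int N})"
      by auto
    moreover have "G (- 1 - int N) = G (- int N - 1)"
      by (rule arg_cong[where f = G]) simp
    ultimately show ?case using Suc by (simp add: D_def algebra_simps)
  qed simp
  moreover have "(\<lambda>N. G (int N) - G (- int N)) \<longlonglongrightarrow> L - L"
  proof (intro tendsto_diff)
    \<comment> \<open>Injective maps pull finite sets back to finite sets.\<close>
    have "filterlim g cofinite sequentially" if "inj g" for g :: "nat \<Rightarrow> int"
      using that unfolding filterlim_iff eventually_cofinite cofinite_eq_sequentially[symmetric]
      by (auto dest: finite_vimageI[where h = g] simp: vimage_def)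
    from this[of int] this[of "\<lambda>n. - int n"]
    show "(\<lambda>N. G (int N)) \<longlonglongrightarrow> L" "(\<lambda>N. G (- int N)) \<longlonglongrightarrow> L"
      by (auto intro!: filterlim_compose[OF assms(1)] simp: inj_def)
  qed
  ultimately have "S = 0" by (simp add: LIMSEQ_unique)
  with S show ?thesis by (simp add: D_def)
qed

section \<open>Reflection formulas for the digamma function and its derivative\<close>

lemma Digamma_reflection_complex:
  fixes z :: complex
  assumes "z \<notin> \<int>"
  shows "Digamma (1 - z) - Digamma z = of_real pi * cot (of_real pi * z)"
proof -
  have z: "z \<notin> \<int>\<^sub>\<le>\<^sub>0" "1 - z \<notin> \<int>\<^sub>\<le>\<^sub>0"
    using assms Ints_diff[of 1 "1 - z"] nonpos_Ints_Int by auto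
  have nz: "sin (of_real pi * z) \<noteq> 0"
    using assms by (auto simp: sin_eq_0)
  \<comment> \<open>With the reciprocal Gamma function, reflection reads
    \<open>rGamma z * rGamma (1 - z) = sin (pi * z) / pi\<close>, an identity of entire functions.
    Both sides are differentiated and compared.\<close>
  have "((\<lambda>z. rGamma z * rGamma (1 - z)) has_field_derivative
          rGamma z * rGamma (1 - z) * (Digamma (1 - z) - Digamma z)) (at z)"
    using z by (auto intro!: derivative_eq_intros simp: algebra_simps)
  moreover have "((\<lambda>z. sin (of_real pi * z) / of_real pi) has_field_derivative cos (of_real pi * z)) (at z)"
    by (auto intro!: derivative_eq_intros)
  ultimately have "sin (of_real pi * z) / of_real pi * (Digamma (1 - z) - Digamma z) = cos (of_real pi * z)"
    unfolding rGamma_reflection_complex by (rule DERIV_unique)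
  thus ?thesis using nz by (simp add: cot_def field_simps)
qed

lemma Polygamma_1_reflection_complex:
  fixes z :: complex
  assumes "z \<notin> \<int>"
  shows "Polygamma 1 z + Polygamma 1 (1 - z) = (of_real pi / sin (of_real pi * z))\<^sup>2"
proof -
  have z: "z \<notin> \<int>\<^sub>\<le>\<^sub>0" "1 - z \<notin> \<int>\<^sub>\<le>\<^sub>0"
    using assms Ints_diff[of 1 "1 - z"] nonpos_Ints_Int by auto
  have nz: "sin (of_real pi * z) \<noteq> 0"
    using assms by (auto simp: sin_eq_0)
  have *: "((\<lambda>z. Digamma (1 - z) - Digamma z) has_field_derivative
           - Polygamma 1 (1 - z) - Polygamma 1 z) (at z)"
    using z by (auto intro!: derivative_eq_intros)
  have "((\<lambda>z. of_real pi * cot (of_real pi * z)) has_field_derivative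
           - Polygamma 1 (1 - z) - Polygamma 1 z) (at z)"
    \<comment> \<open>The digamma reflection formula holds off the integers, an open set, so the two
      functions agree near \<open>z\<close> and share their derivative.\<close>
    using * by (rule DERIV_cong_ev[OF refl _ refl, THEN iffD1, rotated])
       (use assms in \<open>auto intro!: eventually_mono[OF eventually_nhds_in_open[of "- \<int>"]]
          simp: Digamma_reflection_complex closed_Ints\<close>)
  moreover have "((\<lambda>z. of_real pi * cot (of_real pi * z)) has_field_derivative
           - (of_real pi / sin (of_real pi * z))\<^sup>2) (at z)"
    using nz by (auto intro!: derivative_eq_intros DERIV_chain2[OF DERIV_cot] simp: field_simps power2_eq_square)
  ultimately have "- Polygamma 1 (1 - z) - Polygamma 1 z = - (of_real pi / sin (of_real pi * z))\<^sup>2"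
    by (rule DERIV_unique)
  thus ?thesis by (simp add: algebra_simps)
qed

section \<open>Closed forms of the bilateral sums with quadratic denominator\<close>

lemma has_sum_bilateral_inverse_square:
  fixes a :: complex
  assumes "a \<notin> \<int>" "(\<lambda>n :: int. 1 / (of_int n + a)\<^sup>2) summable_on UNIV"
  shows   "((\<lambda>n :: int. 1 / (of_int n + a)\<^sup>2) has_sum (of_real pi / sin (of_real pi * a))\<^sup>2) UNIV"
proof -
  have nz: "a \<noteq> 0" "1 - a \<noteq> 0" using assms(1) by auto
  have "(\<lambda>n. 1 / (of_int (int n) + a)\<^sup>2) sums Polygamma 1 a"
    using Polygamma_LIMSEQ[of a 1] nz by (simp add: divide_inverse numeral_2_eq_2 add_ac)
  \<comment> \<open>Reversing the negative half replaces \<open>a\<close> by \<open>1 - a\<close>;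
    the square absorbs the sign.\<close>
  moreover have "(of_int (- int n - 1) + a)\<^sup>2 = (1 - a + of_nat n)\<^sup>2" for n
    by (simp add: power2_eq_square algebra_simps)
  hence "(\<lambda>n. 1 / (of_int (- int n - 1) + a)\<^sup>2) sums Polygamma 1 (1 - a)"
    using Polygamma_LIMSEQ[of "1 - a" 1] nz by (simp add: divide_inverse numeral_2_eq_2 del: of_int_diff)
  ultimately show ?thesis
    unfolding Polygamma_1_reflection_complex[OF assms(1), symmetric]
    by (intro has_sum_int_sums assms)
qed

text \<open>Partial fractions turn the series into a difference of two digamma series, in which the
  harmonic terms and Euler's constant cancel.\<close>

lemma sums_inverse_product_Digamma:
  fixes a c :: complex
  assumes "a \<notin> \<int>" "c \<notin> \<int>" "a \<noteq> c"
  shows   "(\<lambda>n. 1 / ((a + of_nat n) * (c + of_nat n))) sums ((Digamma c - Digamma a) / (c - a))"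
proof -
  have D: "(\<lambda>n. inverse (of_nat (Suc n)) - inverse (z + of_nat n)) sums (Digamma z + euler_mascheroni)"
    if "z \<notin> \<int>" for z :: complex
  proof -
    have "z \<noteq> 0" using that by auto
    thus ?thesis using summable_sums[OF summable_Digamma[of z]] by (simp add: Digamma_def)
  qed
  have nz: "a + of_nat n \<noteq> 0" "c + of_nat n \<noteq> 0" for n
    using assms Ints_of_nat[of n, where 'a = complex] by (metis Ints_minus add_eq_0_iff2)+
  have "(\<lambda>n. (inverse (a + of_nat n) - inverse (c + of_nat n)) / (c - a)) sums
          ((Digamma c - Digamma a) / (c - a))"
    using sums_divide[OF sums_diff[OF D[OF assms(2)] D[OF assms(1)]], of "c - a"] by simp
  also have "(\<lambda>n. (inverse (a + of_nat n) - inverse (c + of_nat n)) / (c - a)) =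
             (\<lambda>n. 1 / ((a + of_nat n) * (c + of_nat n)))"
    using nz assms(3) by (auto simp: fun_eq_iff divide_simps)
  finally show ?thesis .
qed

text \<open>The halves yield digamma differences at \<open>a\<close>, \<open>c\<close> and at
  \<open>1 - a\<close>, \<open>1 - c\<close>. Reflection regroups them into a difference of
  cotangents, and the subtraction formula for sine does the rest.\<close>

lemma has_sum_bilateral_inverse_product:
  fixes a c :: complex
  assumes "a \<notin> \<int>" "c \<notin> \<int>" "a \<noteq> c"
    and "(\<lambda>n :: int. 1 / ((of_int n + a) * (of_int n + c))) summable_on UNIV"
  shows   "((\<lambda>n :: int. 1 / ((of_int n + a) * (of_int n + c))) has_sum
             (of_real pi * sin (of_real pi * (a - c)) /
               ((a - c) * sin (of_real pi * a) * sin (of_real pi * c)))) UNIV"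
proof -
  have "(\<lambda>n. 1 / ((of_int (int n) + a) * (of_int (int n) + c))) sums ((Digamma c - Digamma a) / (c - a))"
    using sums_inverse_product_Digamma[OF assms(1-3)] by (simp add: add_ac)
  moreover have "1 - a \<notin> \<int>" "1 - c \<notin> \<int>"
    using assms Ints_diff[of 1 "1 - a"] Ints_diff[of 1 "1 - c"] by auto
  from sums_inverse_product_Digamma[OF this]
  have "(\<lambda>n. 1 / ((of_int (- int n - 1) + a) * (of_int (- int n - 1) + c))) sums
           ((Digamma (1 - c) - Digamma (1 - a)) / (a - c))"
    using assms(3) by (simp add: algebra_simps)
  ultimately have "((\<lambda>n :: int. 1 / ((of_int n + a) * (of_int n + c))) has_sum
      ((Digamma c - Digamma a) / (c - a) + (Digamma (1 - c) - Digamma (1 - a)) / (a - c))) UNIV"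
    by (intro has_sum_int_sums assms)
  also have "(Digamma c - Digamma a) / (c - a) + (Digamma (1 - c) - Digamma (1 - a)) / (a - c) =
    ((Digamma (1 - c) - Digamma c) - (Digamma (1 - a) - Digamma a)) / (a - c)"
    using assms(3) by (simp add: divide_simps) (simp add: algebra_simps)
  also have "\<dots> = of_real pi * (cot (of_real pi * c) - cot (of_real pi * a)) / (a - c)"
    using assms by (simp add: Digamma_reflection_complex algebra_simps)
  also have "\<dots> = of_real pi * sin (of_real pi * (a - c)) /
               ((a - c) * sin (of_real pi * a) * sin (of_real pi * c))"
  proof -
    have "sin (of_real pi * a) \<noteq> 0" "sin (of_real pi * c) \<noteq> 0"
      using assms by (auto simp: sin_eq_0)
    thus ?thesis
      using assms(3) by (simp add: cot_def right_diff_distrib sin_diff divide_simps) (simp add: algebra_simps)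
  qed
  finally show ?thesis .
qed

lemma Gamma_1_plus_Gamma_1_minus:
  fixes z :: complex
  assumes "z \<notin> \<int>"
  shows "Gamma (1 + z) * Gamma (1 - z) = of_real pi * z / sin (of_real pi * z)"
proof -
  have "Gamma (1 + z) = z * Gamma z"
    using Gamma_plus1[of z] assms nonpos_Ints_Int by (auto simp: add_ac)
  thus ?thesis
    using Gamma_reflection_complex[of z] by (simp add: mult_ac)
qed

text \<open>The sine form breaks down at \<open>a = c\<close>, whereas the Gamma form covers this
  removable singularity too. For \<open>a \<noteq> c\<close> the factors pair up as
  \<open>Gamma (1 + z) * Gamma (1 - z)\<close> with \<open>z\<close> equal to \<open>a\<close>,
  \<open>c\<close> and \<open>a - c\<close>.\<close>

lemma has_sum_bilateral_inverse_product_Gamma: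
  fixes a c :: complex
  assumes "a \<notin> \<int>" "c \<notin> \<int>" "a - c \<notin> \<int> - {0}"
    and "(\<lambda>n :: int. 1 / ((of_int n + a) * (of_int n + c))) summable_on UNIV"
  shows   "((\<lambda>n :: int. 1 / ((of_int n + a) * (of_int n + c))) has_sum
             (Gamma (1 + a) * Gamma (1 - a) * Gamma (1 + c) * Gamma (1 - c) /
               (Gamma (1 + a - c) * Gamma (1 + c - a)) / (a * c))) UNIV"
proof (cases "a = c")
  case True
  have "a \<noteq> 0" using assms by auto
  have "((\<lambda>n :: int. 1 / (of_int n + a)\<^sup>2) has_sum (of_real pi / sin (of_real pi * a))\<^sup>2) UNIV"
    using assms True by (intro has_sum_bilateral_inverse_square) (auto simp: power2_eq_square)
  also have "(of_real pi / sin (of_real pi * a))\<^sup>2 =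
     (Gamma (1 + a) * Gamma (1 - a)) * (Gamma (1 + a) * Gamma (1 - a)) / (a * a)"
    using \<open>a \<noteq> 0\<close> assms by (simp add: Gamma_1_plus_Gamma_1_minus power2_eq_square)
  finally show ?thesis using True by (simp add: power2_eq_square mult_ac)
next
  case False
  hence ac: "a - c \<notin> \<int>" using assms by auto
  have nz: "a \<noteq> 0" "c \<noteq> 0" "a - c \<noteq> 0" using assms False by auto
  have sin_nz: "sin (of_real pi * (a - c)) \<noteq> 0" "sin (of_real pi * a) \<noteq> 0" "sin (of_real pi * c) \<noteq> 0"
    using ac assms by (auto simp: sin_eq_0)
  have "Gamma (1 + a) * Gamma (1 - a) * Gamma (1 + c) * Gamma (1 - c) /
               (Gamma (1 + a - c) * Gamma (1 + c - a)) =
        (Gamma (1 + a) * Gamma (1 - a)) * (Gamma (1 + c) * Gamma (1 - c)) /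
               (Gamma (1 + (a - c)) * Gamma (1 - (a - c)))"
    by (simp add: algebra_simps)
  also have "\<dots> = a * c * (of_real pi * sin (of_real pi * (a - c)) /
               ((a - c) * sin (of_real pi * a) * sin (of_real pi * c)))"
    using assms ac nz sin_nz by (subst (1 2 3) Gamma_1_plus_Gamma_1_minus) (auto simp: field_simps)
  finally show ?thesis
    using has_sum_bilateral_inverse_product[OF assms(1,2) False assms(4)] nz by simp
qed

lemma not_Ints_imp_nonzero: "x \<notin> \<int> \<Longrightarrow> x \<noteq> 0"
  by auto

lemma Gamma_nonzero_not_Ints: "x \<notin> \<int> \<Longrightarrow> Gamma (x :: complex) \<noteq> 0"
  using nonpos_Ints_Int by (auto simp: Gamma_eq_zero_iff)

lemma Gamma_plus1_not_Ints: "x \<notin> \<int> \<Longrightarrow> Gamma (x + 1 :: complex) = x * Gamma x"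
  using nonpos_Ints_Int by (intro Gamma_plus1) auto

section \<open>The summand: shift rules and decay\<close>

context
  fixes a c \<beta> :: complex
  assumes a: "a \<notin> \<int>" and c: "c \<notin> \<int>"
begin

text \<open>Gamma quotients treat all integers \<open>k\<close> and \<open>n\<close> alike. The last
  factor is kept as a polynomial in \<open>n\<close>, meaningful for every
  \<open>\<beta>\<close>.\<close>

definition bilateral_term :: "int \<Rightarrow> nat \<Rightarrow> int \<Rightarrow> complex" where
  "bilateral_term k M n =
     Gamma (of_int n + a) / Gamma (of_int n + a + of_int k + 1)
     * (Gamma (of_int n + c + of_int k) / Gamma (of_int n + c + of_nat M + 1))
     * pochhammer (of_int n + \<beta>) M"

lemma not_zero_shift:
  "of_int n + a \<noteq> 0" "of_int n + c \<noteq> 0" "of_int n + a + of_int k \<noteq> 0" "of_int n + c + of_int k \<noteq> 0"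
  "of_int n + a + of_int k + 1 \<noteq> 0" "of_int n + c + of_nat M + 1 \<noteq> 0"
  by (intro not_Ints_imp_nonzero; simp add: a c)+

lemma Gamma_shift:
  "Gamma (of_int n + a + 1) = (of_int n + a) * Gamma (of_int n + a)"
  "Gamma (of_int n + c + of_int k + 1) = (of_int n + c + of_int k) * Gamma (of_int n + c + of_int k)"
  "Gamma (of_int n + a + of_int k + 1 + 1) =
     (of_int n + a + of_int k + 1) * Gamma (of_int n + a + of_int k + 1)"
  "Gamma (of_int n + c + of_nat M + 1 + 1) =
     (of_int n + c + of_nat M + 1) * Gamma (of_int n + c + of_nat M + 1)"
  by (intro Gamma_plus1_not_Ints; simp add: a c)+

text \<open>Here and in the next two lemmas a shift of \<open>k\<close>, \<open>M\<close> or
  \<open>n\<close> costs only a rational function of \<open>n\<close>; contiguous relations thereby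
  become polynomial identities.\<close>

lemma bilateral_term_plus1:
  "bilateral_term (k + 1) M n = bilateral_term k M n * (of_int n + c + of_int k) / (of_int n + a + of_int k + 1)"
proof -
  have eq: "of_int n + a + of_int (k + 1) + 1 = of_int n + a + of_int k + 1 + 1"
    "of_int n + c + of_int (k + 1) = of_int n + c + of_int k + 1" by simp_all
  show ?thesis
    unfolding bilateral_term_def eq Gamma_shift by (simp add: mult_ac)
qed

lemma bilateral_term_Suc:
  "bilateral_term k (Suc M) n =
     bilateral_term k M n * (of_int n + \<beta> + of_nat M) / (of_int n + c + of_nat M + 1)"
proof -
  have eq: "of_int n + c + of_nat (Suc M) + 1 = of_int n + c + of_nat M + 1 + 1" by simp
  show ?thesis
    unfolding bilateral_term_def eq Gamma_shift by (simp add: pochhammer_Suc mult_ac)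
qed

text \<open>The factor \<open>n + \<beta>\<close> stays on the left since it may vanish.\<close>

lemma bilateral_term_shift:
  "bilateral_term k M (n + 1) * (of_int n + \<beta>) = bilateral_term k M n *
     ((of_int n + \<beta> + of_nat M) * (of_int n + a) * (of_int n + c + of_int k)
       / ((of_int n + a + of_int k + 1) * (of_int n + c + of_nat M + 1)))"
proof -
  have eq: "of_int (n + 1) + a = of_int n + a + 1"
    "of_int n + a + 1 + of_int k + 1 = of_int n + a + of_int k + 1 + 1"
    "of_int (n + 1) + c + of_int k = of_int n + c + of_int k + 1"
    "of_int (n + 1) + c + of_nat M + 1 = of_int n + c + of_nat M + 1 + 1"
    "of_int (n + 1) + \<beta> = of_int n + \<beta> + 1" by simp_all
  \<comment> \<open>Both sides equal the Pochhammer symbol of length \<open>M + 1\<close> at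
    \<open>n + \<beta>\<close>, split off at its first and at its last factor.\<close>
  have "pochhammer (of_int n + \<beta> + 1) M * (of_int n + \<beta>) =
          pochhammer (of_int n + \<beta>) M * (of_int n + \<beta> + of_nat M)"
    using pochhammer_rec[of "of_int n + \<beta>" M] by (simp add: pochhammer_Suc mult_ac)
  hence P: "X * pochhammer (of_int n + \<beta> + 1) M * (of_int n + \<beta>) =
      X * (pochhammer (of_int n + \<beta>) M * (of_int n + \<beta> + of_nat M))" for X
    by simp
  show ?thesis
    unfolding bilateral_term_def eq P Gamma_shift by (simp add: mult_ac)
qed

lemma bilateral_term_0_0: "bilateral_term 0 0 n = 1 / ((of_int n + a) * (of_int n + c))"
proof -
  have "Gamma (of_int n + a) \<noteq> 0" "Gamma (of_int n + c) \<noteq> 0"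
    by (intro Gamma_nonzero_not_Ints; simp add: a c)+
  thus ?thesis
    using Gamma_shift(1)[of n] Gamma_shift(2)[of n 0] by (simp add: bilateral_term_def)
qed

text \<open>Each shift of \<open>k\<close> or \<open>M\<close> multiplies the summand by a ratio
  tending to 1, so everything follows from \<open>k = M = 0\<close>. The exact limit, not just a
  bound, is what telescoping needs later.\<close>

lemma bilateral_term_decay:
  "((\<lambda>n. (of_int n)\<^sup>2 * bilateral_term k M n) \<longlongrightarrow> 1) cofinite"
proof (induction M)
  case 0
  show ?case
  proof (induction k rule: int_induct[where k = 0])
    case base
    have "((\<lambda>n. ((of_int n + 0) / (of_int n + a)) * ((of_int n + 0) / (of_int n + c))) \<longlongrightarrow> 1 * 1) cofinite"
      by (intro tendsto_mult tendsto_shift_ratio)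
    thus ?case by (simp add: bilateral_term_0_0 power2_eq_square)
  next
    case (step1 k)
    have "((\<lambda>n. (of_int n)\<^sup>2 * bilateral_term k 0 n *
            ((of_int n + (c + of_int k)) / (of_int n + (a + of_int k + 1)))) \<longlongrightarrow> 1 * 1) cofinite"
      by (intro tendsto_mult tendsto_shift_ratio step1)
    moreover have "(of_int n)\<^sup>2 * bilateral_term k 0 n * ((of_int n + (c + of_int k)) / (of_int n + (a + of_int k + 1))) =
        (of_int n)\<^sup>2 * bilateral_term (k + 1) 0 n" for n
      unfolding bilateral_term_plus1 by (simp add: add.assoc mult.assoc)
    ultimately show ?case by (simp only: mult_1)
  next
    case (step2 k)
    \<comment> \<open>The downward step inverts the shift rule in \<open>k\<close>; the new
      denominator is nonzero because \<open>c\<close> is not an integer.\<close>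
    have "((\<lambda>n. (of_int n)\<^sup>2 * bilateral_term k 0 n *
            ((of_int n + (a + of_int k)) / (of_int n + (c + of_int k - 1)))) \<longlongrightarrow> 1 * 1) cofinite"
      by (intro tendsto_mult tendsto_shift_ratio step2)
    moreover have "bilateral_term k 0 n *
            ((of_int n + (a + of_int k)) / (of_int n + (c + of_int k - 1))) = bilateral_term (k - 1) 0 n" for n
      using bilateral_term_plus1[of "k - 1" 0 n] not_zero_shift(3,4)[of n k] not_zero_shift(4)[of n "k - 1"]
      by (simp add: field_simps)
    ultimately show ?case by (simp only: mult.assoc mult_1)
  qed
next
  case (Suc M)
  have "((\<lambda>n. (of_int n)\<^sup>2 * bilateral_term k M n *
          ((of_int n + (\<beta> + of_nat M)) / (of_int n + (c + of_nat M + 1)))) \<longlongrightarrow> 1 * 1) cofinite"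
    by (intro tendsto_mult tendsto_shift_ratio Suc)
  thus ?case by (simp add: bilateral_term_Suc add_ac mult.assoc)
qed

lemma summable_bilateral_term: "bilateral_term k M summable_on UNIV"
  using bilateral_term_decay by (rule summable_on_int_quadratic_decay)

text \<open>This gives the boundary values of the telescoping functions:
  \<open>(n + x) * (n + y)\<close> is asymptotic to the square of \<open>n\<close>.\<close>

lemma tendsto_bilateral_term_quadratic:
  "((\<lambda>n. bilateral_term k M n * (of_int n + x) * (of_int n + y)) \<longlongrightarrow> 1) cofinite"
proof -
  have "((\<lambda>n. (of_int n)\<^sup>2 * bilateral_term k M n * ((of_int n + x) / (of_int n + 0))
          * ((of_int n + y) / (of_int n + 0))) \<longlongrightarrow> 1 * 1 * 1) cofinite"
    by (intro tendsto_mult tendsto_shift_ratio bilateral_term_decay)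
  moreover have "eventually (\<lambda>n :: int. n \<noteq> 0) cofinite"
    by (simp add: eventually_cofinite)
  hence "eventually (\<lambda>n. (of_int n)\<^sup>2 * bilateral_term k M n * ((of_int n + x) / (of_int n + 0))
          * ((of_int n + y) / (of_int n + 0)) = bilateral_term k M n * (of_int n + x) * (of_int n + y)) cofinite"
    by eventually_elim (simp add: power2_eq_square)
  ultimately show ?thesis by (auto intro: Lim_transform_eventually)
qed

section \<open>Contiguous relations for the sum, by telescoping\<close>

definition bilateral_sum :: "int \<Rightarrow> nat \<Rightarrow> complex" where
  "bilateral_sum k M = infsum (bilateral_term k M) UNIV"

lemma bilateral_sum: "(bilateral_term k M has_sum bilateral_sum k M) UNIV"
  unfolding bilateral_sum_def by (intro has_sum_infsum summable_bilateral_term)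

text \<open>The summand times a monic quadratic tends to 1 at both ends, so its differences sum to
  0. Only a termwise certificate remains to be checked for each recurrence.\<close>

lemma bilateral_sum_contiguous:
  assumes "\<And>n. bilateral_term k M (n + 1) * (of_int (n + 1) + x) * (of_int (n + 1) + y)
              - bilateral_term k M n * (of_int n + x) * (of_int n + y)
              = A * bilateral_term k' M' n - B * bilateral_term k M n"
  shows   "A * bilateral_sum k' M' = B * bilateral_sum k M"
proof -
  have *: "((\<lambda>n. A * bilateral_term k' M' n - B * bilateral_term k M n) has_sum
          (A * bilateral_sum k' M' - B * bilateral_sum k M)) UNIV"
    unfolding diff_conv_add_uminus by (intro has_sum_add has_sum_uminusI has_sum_cmult_right bilateral_sum)
  moreover have "((\<lambda>n. A * bilateral_term k' M' n - B * bilateral_term k M n) has_sum 0) UNIV"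
    \<comment> \<open>Summability of the differences is read off from the right-hand side of the
      certificate.\<close>
    using has_sum_int_telescope[OF tendsto_bilateral_term_quadratic[of k M x y]] has_sum_imp_summable[OF *]
    unfolding assms by blast
  ultimately have "A * bilateral_sum k' M' - B * bilateral_sum k M = 0"
    by (rule has_sum_unique)
  thus ?thesis by simp
qed


text \<open>At \<open>n + 1\<close> the chosen quadratic becomes \<open>(n + \<beta>) * q\<close>:
  the first factor enables the shift rule in \<open>n\<close>, the second cancels one denominator.
  What remains is \<open>p\<close>, the denominator of the shift in \<open>k\<close>.\<close>

lemma bilateral_sum_plus1:
  "(of_int k + 1) * (a + 1 - \<beta> - of_nat M + of_int k) * bilateral_sum (k + 1) M =
     (1 + c - \<beta> + of_int k) * (of_int k - of_nat M) * bilateral_sum k M"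
proof (rule bilateral_sum_contiguous[where x = "\<beta> - 1" and y = "c + of_nat M"])
  fix n :: int
  define F where "F = bilateral_term k M n"
  define p where "p = of_int n + a + of_int k + 1"
  define q where "q = of_int n + c + of_nat M + 1"
  let ?X = "(of_int n + \<beta> + of_nat M) * (of_int n + a) * (of_int n + c + of_int k)"
  let ?Y = "(of_int n + (\<beta> - 1)) * (of_int n + (c + of_nat M))"
  let ?A = "(of_int k + 1) * (a + 1 - \<beta> - of_nat M + of_int k)"
  let ?B = "(1 + c - \<beta> + of_int k) * (of_int k - of_nat M)"
  have nz: "p \<noteq> 0" "q \<noteq> 0" using not_zero_shift by (auto simp: p_def q_def)
  have "bilateral_term k M (n + 1) * (of_int (n + 1) + (\<beta> - 1)) * (of_int (n + 1) + (c + of_nat M)) =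
          bilateral_term k M (n + 1) * (of_int n + \<beta>) * q"
    by (simp add: q_def algebra_simps)
  also have "\<dots> = F * ?X / p"
    unfolding bilateral_term_shift using nz by (simp add: F_def flip: p_def q_def)
  finally have G: "bilateral_term k M (n + 1) * (of_int (n + 1) + (\<beta> - 1)) * (of_int (n + 1) + (c + of_nat M))
      = F * ?X / p" .
  \<comment> \<open>The certificate with \<open>F / p\<close> factored out: a polynomial
    identity.\<close>
  have "?X - ?Y * p = ?A * (of_int n + c + of_int k) - ?B * p"
    unfolding p_def by algebra
  hence "F * (?X - ?Y * p) / p = F * (?A * (of_int n + c + of_int k) - ?B * p) / p" by simp
  hence "F * ?X / p - F * ?Y = ?A * (F * (of_int n + c + of_int k) / p) - ?B * F"
    using nz by (simp add: right_diff_distrib diff_divide_distrib mult_ac)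
  thus "bilateral_term k M (n + 1) * (of_int (n + 1) + (\<beta> - 1)) * (of_int (n + 1) + (c + of_nat M))
      - bilateral_term k M n * (of_int n + (\<beta> - 1)) * (of_int n + (c + of_nat M)) =
      ?A * bilateral_term (k + 1) M n - ?B * bilateral_term k M n"
    unfolding G bilateral_term_plus1 by (simp add: F_def p_def mult.assoc)
qed

text \<open>With \<open>y = a\<close> the quadratic at \<open>n + 1\<close> cancels \<open>p\<close>
  instead, leaving \<open>q\<close>, the denominator of the shift in \<open>M\<close>.\<close>

lemma bilateral_sum_Suc:
  "(c - a + 1 + of_nat M) * bilateral_sum 0 (Suc M) = (\<beta> - a + of_nat M) * bilateral_sum 0 M"
proof -
  \<comment> \<open>The certificate produces the common factor \<open>M + 1\<close> in both
    coefficients; it is cancelled at the end.\<close>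
  let ?A = "(of_nat M + 1) * (c - a + 1 + of_nat M)"
  let ?B = "(of_nat M + 1) * (\<beta> - a + of_nat M)"
  have "?A * bilateral_sum 0 (Suc M) = ?B * bilateral_sum 0 M"
  proof (rule bilateral_sum_contiguous[where x = "\<beta> - 1" and y = a])
    fix n :: int
    define F where "F = bilateral_term 0 M n"
    define p where "p = of_int n + a + 1"
    define q where "q = of_int n + c + of_nat M + 1"
    let ?X = "(of_int n + \<beta> + of_nat M) * (of_int n + a) * (of_int n + c)"
    let ?Y = "(of_int n + (\<beta> - 1)) * (of_int n + a)"
    have nz: "p \<noteq> 0" "q \<noteq> 0" using not_zero_shift(5)[of n 0] not_zero_shift(6) by (auto simp: p_def q_def)
    have "bilateral_term 0 M (n + 1) * (of_int (n + 1) + (\<beta> - 1)) * (of_int (n + 1) + a) =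
            bilateral_term 0 M (n + 1) * (of_int n + \<beta>) * p"
      by (simp add: p_def algebra_simps)
    also have "\<dots> = F * ?X / q"
      unfolding bilateral_term_shift using nz by (simp add: F_def flip: p_def q_def)
    finally have G: "bilateral_term 0 M (n + 1) * (of_int (n + 1) + (\<beta> - 1)) * (of_int (n + 1) + a)
        = F * ?X / q" .
    have "?X - ?Y * q = ?A * (of_int n + \<beta> + of_nat M) - ?B * q"
      unfolding q_def by algebra
    hence "F * (?X - ?Y * q) / q = F * (?A * (of_int n + \<beta> + of_nat M) - ?B * q) / q" by simp
    hence "F * ?X / q - F * ?Y = ?A * (F * (of_int n + \<beta> + of_nat M) / q) - ?B * F"
      using nz by (simp add: right_diff_distrib diff_divide_distrib mult_ac)
    thus "bilateral_term 0 M (n + 1) * (of_int (n + 1) + (\<beta> - 1)) * (of_int (n + 1) + a)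
        - bilateral_term 0 M n * (of_int n + (\<beta> - 1)) * (of_int n + a) =
        ?A * bilateral_term 0 (Suc M) n - ?B * bilateral_term 0 M n"
      unfolding G bilateral_term_Suc by (simp add: F_def q_def mult.assoc)
  qed
  moreover have "(of_nat M + 1 :: complex) \<noteq> 0"
    using of_nat_neq_0[of M] by (simp add: add.commute)
  ultimately show ?thesis by (simp add: mult.assoc)
qed

section \<open>Evaluation of the sum from its initial value\<close>

lemma bilateral_sum_0_0:
  assumes "a - c \<notin> \<int> - {0}"
  shows "bilateral_sum 0 0 = Gamma (1 + a) * Gamma (1 - a) * Gamma (1 + c) * Gamma (1 - c) /
               (Gamma (1 + a - c) * Gamma (1 + c - a)) / (a * c)"
proof -
  have eq: "bilateral_term 0 0 = (\<lambda>n. 1 / ((of_int n + a) * (of_int n + c)))"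
    by (intro ext bilateral_term_0_0)
  show ?thesis
    using has_sum_bilateral_inverse_product_Gamma[OF a c assms] summable_bilateral_term[of 0 0]
      bilateral_sum[of 0 0] unfolding eq by (blast intro: has_sum_unique)
qed

text \<open>Iteration of the recurrence in \<open>M\<close>; the condition on \<open>a - c\<close>
  keeps each divisor \<open>c - a + 1 + M\<close> nonzero.\<close>

lemma bilateral_sum_0:
  assumes "a - c \<notin> \<int> - {0}"
  shows "bilateral_sum 0 M = bilateral_sum 0 0 * pochhammer (\<beta> - a) M / pochhammer (1 + c - a) M"
proof (induction M)
  case (Suc M)
  have "c - a + 1 + of_nat M \<noteq> 0"
  proof
    assume "c - a + 1 + of_nat M = 0"
    hence "a - c = of_nat (Suc M)" by (simp add: algebra_simps)
    hence "a - c \<in> \<int> - {0}" by (simp del: of_nat_Suc)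
    with assms show False by blast
  qed
  hence "bilateral_sum 0 (Suc M) = (\<beta> - a + of_nat M) * bilateral_sum 0 M / (c - a + 1 + of_nat M)"
    using bilateral_sum_Suc[of M] by (metis nonzero_mult_div_cancel_left)
  also have "c - a + 1 + of_nat M = 1 + c - a + of_nat M" by simp
  finally show ?case
    unfolding Suc.IH pochhammer_Suc by (simp only: times_divide_eq_left times_divide_eq_right divide_divide_eq_left mult_ac)
qed simp

text \<open>At \<open>k = -1\<close> the left coefficient of the recurrence in \<open>k\<close>
  vanishes but the right one does not, so the sum is 0 there. The right coefficient is nonzero for
  all negative indices, which carries the zero downwards.\<close>

lemma bilateral_sum_neg:
  assumes "1 + c - \<beta> \<notin> \<int>" "k < 0"
  shows "bilateral_sum k M = 0"
proof -
  have nz: "(1 + c - \<beta> + of_int j) * (of_int j - of_nat M) \<noteq> 0" if "j < 0" for j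
  proof -
    have "1 + c - \<beta> + of_int j \<noteq> 0"
      by (rule not_Ints_imp_nonzero, subst add_in_Ints_iff_right) (use assms(1) in auto)
    moreover have "of_int j - of_nat M = (of_int (j - int M) :: complex)" by simp
    hence "of_int j - of_nat M \<noteq> (0 :: complex)"
      using that by (simp only: of_int_eq_0_iff)
    ultimately show ?thesis by simp
  qed
  show ?thesis using assms(2)
  proof (induction k rule: int_less_induct)
    case base
    show ?case using bilateral_sum_plus1[of "-1" M] nz[of "-1"] by simp
  next
    case (step k)
    thus ?case using bilateral_sum_plus1[of "k - 1" M] nz[of "k - 1"] by simp
  qed
qed

end

lemma shifted_factorial_of_nat: "shifted_factorial x (int m) = pochhammer x m"
  by (simp add: shifted_factorial_def pochhammer_prod atLeast0LessThan)

text \<open>Upward iteration of the recurrence in \<open>k\<close> from 0. Vanishing for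
  \<open>m > M\<close> is built into the Pochhammer symbol of \<open>- M\<close>.\<close>

lemma bilateral_sum_nonneg:
  assumes "a \<notin> \<int>" "c \<notin> \<int>" "a + 1 - \<beta> \<notin> \<int>"
  shows "bilateral_sum a c \<beta> (int m) M = bilateral_sum a c \<beta> 0 M *
    (pochhammer (- of_nat M) m * pochhammer (1 + c - \<beta>) m /
      (pochhammer 1 m * pochhammer (a + 1 - \<beta> - of_nat M) m))"
proof (induction m)
  case (Suc m)
  let ?A = "(of_nat m + 1) * (a + 1 - \<beta> - of_nat M + of_nat m)"
  have "a + 1 - \<beta> - of_nat M + of_nat m \<noteq> 0"
  proof (rule not_Ints_imp_nonzero)
    show "a + 1 - \<beta> - of_nat M + of_nat m \<notin> \<int>"
      by (subst add_in_Ints_iff_right, simp, subst diff_in_Ints_iff_right, simp, fact assms)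
  qed
  moreover have "(of_nat m + 1 :: complex) \<noteq> 0"
    using of_nat_neq_0[of m] by (simp add: add.commute)
  ultimately have "?A \<noteq> 0" by simp
  moreover have "?A * bilateral_sum a c \<beta> (int (Suc m)) M =
      (1 + c - \<beta> + of_nat m) * (of_nat m - of_nat M) * bilateral_sum a c \<beta> (int m) M"
    using bilateral_sum_plus1[OF assms(1,2), of "int m" \<beta> M] by (simp add: add_ac)
  ultimately have "bilateral_sum a c \<beta> (int (Suc m)) M =
      (1 + c - \<beta> + of_nat m) * (of_nat m - of_nat M) * bilateral_sum a c \<beta> (int m) M / ?A"
    by (metis nonzero_mult_div_cancel_left)
  also have "of_nat m - of_nat M = - of_nat M + (of_nat m :: complex)" by simp
  also have "of_nat m + 1 = 1 + (of_nat m :: complex)" by simp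
  finally show ?case
    unfolding Suc.IH pochhammer_Suc by (simp only: times_divide_eq_left times_divide_eq_right divide_divide_eq_left mult_ac)
qed simp

section \<open>Translation into shifted factorials and assembly\<close>

theorem proposition1:
  fixes a b c :: complex and k :: int and M :: nat
  assumes "a \<notin> \<int>" and "b \<notin> \<int>" and "c \<notin> \<int>" and "b - c \<notin> \<int>" and "a + b - c \<notin> \<int>"
    and "a - c \<notin> \<int> - {0}"
  shows "((\<lambda>n :: int.
            (shifted_factorial a n * shifted_factorial (c + of_int k) n
               * shifted_factorial (1 + c - b + of_nat M) n)
            / (shifted_factorial (1 + a + of_int k) n * shifted_factorial (1 + c + of_nat M) n
               * shifted_factorial (1 + c - b) n))
          has_sum
            ((Gamma (1 + a) * Gamma (1 - a) * Gamma (1 + c) * Gamma (1 - c))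
               / (Gamma (1 + a - c) * Gamma (1 + c - a))
             * ((shifted_factorial (- of_nat M) k * shifted_factorial (1 + a) k
                   * shifted_factorial b k)
                / (shifted_factorial 1 k * shifted_factorial c k
                   * shifted_factorial (a + b - c - of_nat M) k))
             * ((shifted_factorial (1 + c) (int M) * shifted_factorial (1 + c - a - b) (int M))
                / (shifted_factorial (1 + c - a) (int M) * shifted_factorial (1 + c - b) (int M)))))
         UNIV"
proof -
  define \<beta> where "\<beta> = 1 + c - b"
  have \<beta>: "\<beta> \<notin> \<int>"
  proof
    assume "\<beta> \<in> \<int>"
    hence "1 - \<beta> \<in> \<int>" by simp
    thus False using assms(4) by (simp add: \<beta>_def)
  qed
  have b: "1 + c - \<beta> = b" and abc: "a + 1 - \<beta> = a + b - c" by (simp_all add: \<beta>_def)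
  define T where "T = bilateral_sum a c \<beta>"
  \<comment> \<open>\<open>K\<close> is the reciprocal of the \<open>bilateral_term\<close> at
    \<open>n = 0\<close>, where the summand of the theorem is 1. It holds the factors of the result
    that \<open>T\<close> does not supply; its \<open>a * c\<close> cancels the one in
    \<open>T 0 0\<close>.\<close>
  define K where "K = a * c * (shifted_factorial (1 + a) k / shifted_factorial c k)
    * (shifted_factorial (1 + c) (int M) / shifted_factorial \<beta> (int M))"
  have nz: "a \<noteq> 0" "c \<noteq> 0" using assms by auto
  have ni: "c + of_int k \<notin> \<int>" "1 + c - b + of_nat M \<notin> \<int>" "1 + a + of_int k \<notin> \<int>"
    "1 + c + of_nat M \<notin> \<int>" "1 + a \<notin> \<int>" "1 + c \<notin> \<int>" "\<beta> + of_nat M \<notin> \<int>"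
    using assms \<beta> by (simp_all add: \<beta>_def)
  have G1: "Gamma (1 + a) = a * Gamma a" "Gamma (1 + c) = c * Gamma c"
    using Gamma_plus1_not_Ints[of a] Gamma_plus1_not_Ints[of c] assms by (simp_all add: add.commute)
  have Gnz: "Gamma a \<noteq> 0" "Gamma c \<noteq> 0" "Gamma \<beta> \<noteq> 0" "Gamma (c + of_int k) \<noteq> 0" "Gamma (\<beta> + of_nat M) \<noteq> 0"
    "Gamma (1 + a + of_int k) \<noteq> 0" "Gamma (1 + c + of_nat M) \<noteq> 0"
    using assms \<beta> ni by (simp_all add: Gamma_nonzero_not_Ints)

  have "(\<lambda>n. K * bilateral_term a c \<beta> k M n) =
    (\<lambda>n. (shifted_factorial a n * shifted_factorial (c + of_int k) n
            * shifted_factorial (1 + c - b + of_nat M) n)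
            / (shifted_factorial (1 + a + of_int k) n * shifted_factorial (1 + c + of_nat M) n
               * shifted_factorial (1 + c - b) n))" (is "_ = ?t")
  proof
    fix n :: int
    \<comment> \<open>As no parameter is an integer, the polynomial factor and all shifted
      factorials become Gamma quotients, and the terms match by cancellation.\<close>
    have "\<beta> + of_int n \<notin> \<int>" using \<beta> by simp
    hence poch: "pochhammer (of_int n + \<beta>) M = Gamma (\<beta> + of_nat M + of_int n) / Gamma (\<beta> + of_int n)"
      using nonpos_Ints_Int by (subst pochhammer_Gamma) (auto simp: add_ac)
    have "Gamma (\<beta> + of_int n) \<noteq> 0" "Gamma (1 + a + of_int k + of_int n) \<noteq> 0" "Gamma (1 + c + of_nat M + of_int n) \<noteq> 0"
      using ni \<beta> by (simp_all add: Gamma_nonzero_not_Ints)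
    moreover have "of_int n + a = a + of_int n" "of_int n + a + of_int k + 1 = 1 + a + of_int k + of_int n"
      "of_int n + c + of_int k = c + of_int k + of_int n" "of_int n + c + of_nat M + 1 = 1 + c + of_nat M + of_int n"
      by simp_all
    ultimately show "K * bilateral_term a c \<beta> k M n = ?t n"
      using nz Gnz ni assms \<beta> unfolding \<beta>_def[symmetric]
      by (simp only: K_def bilateral_term_def[OF assms(1,3)] poch shifted_factorial_eq_Gamma not_False_eq_True
          of_int_of_nat_eq G1)
         (simp add: field_simps)
  qed
  moreover have "((\<lambda>n. K * bilateral_term a c \<beta> k M n) has_sum (K * T k M)) UNIV"
    unfolding T_def by (intro has_sum_cmult_right bilateral_sum assms)
  moreover have "T k M = T 0 M * (shifted_factorial (- of_nat M) k * shifted_factorial b k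
                / (shifted_factorial 1 k * shifted_factorial (a + b - c - of_nat M) k))"
  proof (cases "k < 0")
    case True
    have "T k M = 0"
      unfolding T_def by (rule bilateral_sum_neg) (use assms True b in simp_all)
    \<comment> \<open>For negative \<open>k\<close> this zero stands in a denominator, so the
      right-hand fraction is 0 by the convention for division.\<close>
    moreover have "shifted_factorial 1 k = 0"
      using inverse_shifted_factorial_one_neg[OF True] by simp
    ultimately show ?thesis by simp
  next
    case False
    then obtain m where m: "k = int m" by (metis nonneg_int_cases linorder_not_less)
    show ?thesis
      using bilateral_sum_nonneg[OF assms(1,3), of \<beta> m M] assms(5)
      by (simp only: m T_def shifted_factorial_of_nat b abc simp_thms)
  qed
  \<comment> \<open>Here \<open>\<beta> - a\<close> is \<open>1 + c - a - b\<close>.\<close>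
  moreover have "T 0 M = T 0 0 * shifted_factorial (1 + c - a - b) (int M) / shifted_factorial (1 + c - a) (int M)"
    using bilateral_sum_0[OF assms(1,3,6), of \<beta> M]
    by (simp add: T_def shifted_factorial_of_nat \<beta>_def diff_diff_eq add_ac)
  moreover have "T 0 0 = Gamma (1 + a) * Gamma (1 - a) * Gamma (1 + c) * Gamma (1 - c)
               / (Gamma (1 + a - c) * Gamma (1 + c - a)) / (a * c)"
    unfolding T_def by (intro bilateral_sum_0_0 assms)
  ultimately show ?thesis
    using nz by (simp add: K_def \<beta>_def mult_ac)
qed

end
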